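(* Let $n\ge1$, $a_0,\dots,a_{n-1},b\in\mathbb{R}$ with $b\ne0$, and consider the control system $\dot x_1=x_2,\ \dots,\ \dot x_{n-1}=x_n,\ \dot x_n=-a_0x_1-\dots-a_{n-1}x_n+bu$. Let $\mathfrak{Q}$ be a real quadratic form in $(x_1,\dots,x_n)$, let $\mathfrak{r}\in\mathbb{R}$, $\mathfrak{r}\neq0$, and consider the criterion $J_1=\int_0^T\left(\mathfrak{Q}(x_1,\dots,x_n)+\mathfrak{r}u^2\right)dt$, $T>0$. Then the two-point boundary value problem associated with $J_1$, with prescribed values $x_1(0),\dots,x_n(0),x_1(T),\dots,x_n(T)$, is almost always solvable.
   Context: Put $y=x_1$. Then $x_i=y^{(i-1)}$ for $1\le i\le n$ and $u=b^{-1}\left(y^{(n)}+a_{n-1}y^{(n-1)}+\dots+a_0y\right)$, so that the integrand becomes a quadratic function $\mathcal{L}(y,\dot y,\dots,y^{(n)})$. The associated Euler-Lagrange equation is $\sum_{j=0}^{n}(-1)^j\frac{d^j}{dt^j}\frac{\partial\mathcal{L}}{\partial y^{(j)}}=0$, a linear homogeneous ordinary differential equation in $y$ with constant coefficients. The associated two-point boundary value problem is to find a solution $y$ of this Euler-Lagrange equation such that the corresponding $x_i=y^{(i-1)}$ take the prescribed values at times $0$ and $T$. It is said to be almost always solvable if, for every $T>0$ except perhaps for isolated values of $T$, its solution exists and is unique for any prescribed boundary values. *)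

theory Defs
  imports "HOL-Analysis.Analysis"
begin

text \<open>
  Derivatives are taken relative to a set \<open>S\<close>, which will be the closed time interval
  \<open>{0..T}\<close>; at its end points they are one-sided.
\<close>

definition deriv_within :: "real set \<Rightarrow> (real \<Rightarrow> real) \<Rightarrow> real \<Rightarrow> real" where
  "deriv_within S f t = vector_derivative f (at t within S)"

definition nderiv :: "real set \<Rightarrow> nat \<Rightarrow> (real \<Rightarrow> real) \<Rightarrow> real \<Rightarrow> real" where
  "nderiv S k f = (deriv_within S ^^ k) f"

definition times_differentiable_on :: "nat \<Rightarrow> (real \<Rightarrow> real) \<Rightarrow> real set \<Rightarrow> bool" where
  "times_differentiable_on m y S \<longleftrightarrow> (\<forall>k<m. nderiv S k y differentiable_on S)"

text \<open>
  State vectors \<open>x\<close> are functions on \<open>nat\<close> of which only the values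
  \<open>x 1, \<dots>, x n\<close> matter; jets \<open>v\<close> carry \<open>y\<^sup>(\<^sup>k\<^sup>)\<close> at index \<open>k\<close>.
\<close>

definition quadratic_form :: "nat \<Rightarrow> ((nat \<Rightarrow> real) \<Rightarrow> real) \<Rightarrow> bool" where
  "quadratic_form n Q \<longleftrightarrow>
     (\<exists>q :: nat \<Rightarrow> nat \<Rightarrow> real. \<forall>x. Q x = (\<Sum>i=1..n. \<Sum>j=1..n. q i j * x i * x j))"

definition control_system ::
  "nat \<Rightarrow> (nat \<Rightarrow> real) \<Rightarrow> real \<Rightarrow> real set \<Rightarrow> (real \<Rightarrow> nat \<Rightarrow> real) \<Rightarrow> (real \<Rightarrow> real) \<Rightarrow> bool" where
  "control_system n a b S x u \<longleftrightarrow>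
     (\<forall>t\<in>S.
        (\<forall>i\<in>{1..<n}. ((\<lambda>s. x s i) has_real_derivative x t (Suc i)) (at t within S)) \<and>
        ((\<lambda>s. x s n) has_real_derivative - (\<Sum>i<n. a i * x t (Suc i)) + b * u t) (at t within S))"

definition integrand :: "((nat \<Rightarrow> real) \<Rightarrow> real) \<Rightarrow> real \<Rightarrow> (nat \<Rightarrow> real) \<Rightarrow> real \<Rightarrow> real" where
  "integrand Q r x u = Q x + r * u\<^sup>2"

definition jet :: "real set \<Rightarrow> (real \<Rightarrow> real) \<Rightarrow> real \<Rightarrow> nat \<Rightarrow> real" where
  "jet S y t k = nderiv S k y t"

definition state_of_jet :: "(nat \<Rightarrow> real) \<Rightarrow> nat \<Rightarrow> real" where
  "state_of_jet v i = v (i - 1)"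

definition control_of_jet :: "nat \<Rightarrow> (nat \<Rightarrow> real) \<Rightarrow> real \<Rightarrow> (nat \<Rightarrow> real) \<Rightarrow> real" where
  "control_of_jet n a b v = (v n + (\<Sum>i<n. a i * v i)) / b"

definition lagrangian ::
  "nat \<Rightarrow> (nat \<Rightarrow> real) \<Rightarrow> real \<Rightarrow> ((nat \<Rightarrow> real) \<Rightarrow> real) \<Rightarrow> real \<Rightarrow> (nat \<Rightarrow> real) \<Rightarrow> real" where
  "lagrangian n a b Q r v = integrand Q r (state_of_jet v) (control_of_jet n a b v)"

text \<open>
  The lemmas below show that the substitution \<open>x\<^sub>i = y\<^sup>(\<^sup>i\<^sup>-\<^sup>1\<^sup>)\<close> parametrises the trajectories of the
  control system, so that \<^const>\<open>lagrangian\<close> along the jet of \<open>y\<close> is the integrand of the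
  criterion along the corresponding trajectory.
\<close>

lemma nderiv_has_real_derivative:
  assumes "times_differentiable_on m y S" "k < m" "t \<in> S"
  shows "(nderiv S k y has_real_derivative nderiv S (Suc k) y t) (at t within S)"
  using assms
  by (auto simp: times_differentiable_on_def differentiable_on_def nderiv_def deriv_within_def
      has_real_derivative_iff_has_vector_derivative vector_derivative_works)

lemma control_system_of_jet:
  assumes "n \<ge> 1" "b \<noteq> 0" "times_differentiable_on n y S"
  shows "control_system n a b S (\<lambda>t. state_of_jet (jet S y t)) (\<lambda>t. control_of_jet n a b (jet S y t))"
proof -
  have "((\<lambda>s. nderiv S (i - 1) y s) has_real_derivative nderiv S i y t) (at t within S)"
    if "i \<in> {1..n}" "t \<in> S" for i t
    using nderiv_has_real_derivative[OF assms(3), of "i - 1" t] that by (cases i) auto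
  then show ?thesis
    using assms(1,2)
    by (simp add: control_system_def state_of_jet_def control_of_jet_def jet_def)
qed

lemma nderiv_Suc_eqI:
  assumes "0 < T" "\<And>s. s \<in> {0..T} \<Longrightarrow> nderiv {0..T} k y s = f s"
    and "(f has_real_derivative d) (at t within {0..T})" "t \<in> {0..T}"
  shows "(nderiv {0..T} k y has_real_derivative d) (at t within {0..T})"
    and "nderiv {0..T} (Suc k) y t = d"
proof -
  show *: "(nderiv {0..T} k y has_real_derivative d) (at t within {0..T})"
    using assms by (intro has_field_derivative_transform_within[OF assms(3) zero_less_one]) auto
  show "nderiv {0..T} (Suc k) y t = d"
    using vector_derivative_within_closed_interval[OF assms(1,4)] *
    by (simp add: nderiv_def deriv_within_def has_real_derivative_iff_has_vector_derivative)
qed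

lemma jet_of_control_system:
  assumes "n \<ge> 1" "b \<noteq> 0" "0 < T" "control_system n a b {0..T} x u"
  defines "y \<equiv> \<lambda>t. x t 1"
  shows "times_differentiable_on n y {0..T}"
    and "\<And>t i. t \<in> {0..T} \<Longrightarrow> i \<in> {1..n} \<Longrightarrow> state_of_jet (jet {0..T} y t) i = x t i"
    and "\<And>t. t \<in> {0..T} \<Longrightarrow> control_of_jet n a b (jet {0..T} y t) = u t"
proof -
  note cs = assms(4)[unfolded control_system_def, rule_format]
  have nd: "nderiv {0..T} k y t = x t (Suc k)" if "k < n" "t \<in> {0..T}" for k t
    using that
  proof (induction k arbitrary: t)
    case 0
    then show ?case by (simp add: nderiv_def y_def)
  next
    case (Suc k)
    have "((\<lambda>s. x s (Suc k)) has_real_derivative x t (Suc (Suc k))) (at t within {0..T})"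
      using cs[OF Suc.prems(2)] Suc.prems(1) by simp
    from nderiv_Suc_eqI(2)[OF assms(3) _ this Suc.prems(2)] Suc show ?case
      by simp
  qed
  have top: "nderiv {0..T} n y t = - (\<Sum>i<n. a i * x t (Suc i)) + b * u t" if "t \<in> {0..T}" for t
  proof -
    have "((\<lambda>s. x s (Suc (n - 1))) has_real_derivative - (\<Sum>i<n. a i * x t (Suc i)) + b * u t)
        (at t within {0..T})"
      using cs[OF that] assms(1) by simp
    from nderiv_Suc_eqI(2)[OF assms(3) nd this that] assms(1) show ?thesis
      by (simp del: One_nat_def)
  qed
  show "times_differentiable_on n y {0..T}"
    unfolding times_differentiable_on_def differentiable_on_def
  proof (intro allI impI ballI)
    fix k t assume k: "k < n" and t: "t \<in> {0..T}"
    obtain d where "((\<lambda>s. x s (Suc k)) has_real_derivative d) (at t within {0..T})"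
    proof (cases "Suc k = n")
      case True
      then show ?thesis using cs[OF t] that by blast
    next
      case False
      then have "Suc k \<in> {1..<n}" using k by simp
      then show ?thesis using cs[OF t] that by blast
    qed
    from nderiv_Suc_eqI(1)[OF assms(3) nd[OF k] this t]
    show "nderiv {0..T} k y differentiable at t within {0..T}"
      by (auto simp: real_differentiable_def)
  qed
  show "state_of_jet (jet {0..T} y t) i = x t i" if "t \<in> {0..T}" "i \<in> {1..n}" for t i
    using nd[of "i - 1" t] that by (auto simp: state_of_jet_def jet_def)
  show "control_of_jet n a b (jet {0..T} y t) = u t" if "t \<in> {0..T}" for t
    using top[OF that] nd that assms(2) by (simp add: control_of_jet_def jet_def)
qed

definition partial_deriv :: "nat \<Rightarrow> ((nat \<Rightarrow> real) \<Rightarrow> real) \<Rightarrow> (nat \<Rightarrow> real) \<Rightarrow> real" where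
  "partial_deriv j L v = deriv (\<lambda>s. L (v(j := s))) (v j)"

definition euler_lagrange ::
  "nat \<Rightarrow> ((nat \<Rightarrow> real) \<Rightarrow> real) \<Rightarrow> real set \<Rightarrow> (real \<Rightarrow> real) \<Rightarrow> bool" where
  "euler_lagrange n L S y \<longleftrightarrow>
     (\<forall>t\<in>S. (\<Sum>j\<le>n. (-1) ^ j * nderiv S j (\<lambda>s. partial_deriv j L (jet S y s)) t) = 0)"

text \<open>
  The Euler-Lagrange equation has order \<open>2 * n\<close>, hence the regularity required of solutions.
\<close>

definition bvp_solution ::
  "nat \<Rightarrow> ((nat \<Rightarrow> real) \<Rightarrow> real) \<Rightarrow> real \<Rightarrow> (nat \<Rightarrow> real) \<Rightarrow> (nat \<Rightarrow> real) \<Rightarrow> (real \<Rightarrow> real) \<Rightarrow> bool" where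
  "bvp_solution n L T \<alpha> \<beta> y \<longleftrightarrow>
     times_differentiable_on (2 * n) y {0..T} \<and>
     euler_lagrange n L {0..T} y \<and>
     (\<forall>i\<in>{1..n}. state_of_jet (jet {0..T} y 0) i = \<alpha> i \<and> state_of_jet (jet {0..T} y T) i = \<beta> i)"

definition uniquely_solvable :: "nat \<Rightarrow> ((nat \<Rightarrow> real) \<Rightarrow> real) \<Rightarrow> real \<Rightarrow> bool" where
  "uniquely_solvable n L T \<longleftrightarrow>
     (\<forall>\<alpha> \<beta>.
        (\<exists>y. bvp_solution n L T \<alpha> \<beta> y) \<and>
        (\<forall>y z. bvp_solution n L T \<alpha> \<beta> y \<longrightarrow> bvp_solution n L T \<alpha> \<beta> z \<longrightarrow> (\<forall>t\<in>{0..T}. y t = z t)))"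

text \<open>
  The exceptional times have no accumulation point in \<open>{0<..}\<close>; in particular each of them is isolated.
\<close>

definition almost_always_solvable :: "nat \<Rightarrow> ((nat \<Rightarrow> real) \<Rightarrow> real) \<Rightarrow> bool" where
  "almost_always_solvable n L \<longleftrightarrow> {T. 0 < T \<and> \<not> uniquely_solvable n L T} sparse_in {0<..}"

end

theory Submission
  imports Defs "HOL-Complex_Analysis.Conformal_Mappings" "Jordan_Normal_Form.Determinant"
begin

text \<open>
  The Euler-Lagrange equation is a linear equation of order \<open>2 * n\<close> with constant coefficients, since
  the coefficient of \<open>y\<^sup>(\<^sup>2\<^sup>n\<^sup>)\<close> is a nonzero multiple of \<open>r / b\<^sup>2\<close>. Its solutions are exponential
  generating functions of linear recurrent sequences, hence entire. Unique solvability on \<open>{0..T}\<close>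
  holds as soon as an \<open>n \<times> n\<close> determinant, which is an entire function of \<open>T\<close>, does not vanish. For
  small \<open>T > 0\<close> it does not: a solution with zero boundary values would by Rolle's theorem have a zero
  of each derivative of order below \<open>2 * n\<close> in \<open>{0..T}\<close>, so these derivatives are at most \<open>T\<close> times
  the supremum of the top one, which the equation bounds by a small multiple of itself. So the
  zeros of the determinant are isolated.
\<close>

subsection \<open>Exponential generating functions\<close>

text \<open>This growth condition makes the exponential generating function converge everywhere, so
  that \<open>egf\<close> is entire.\<close>

definition geom_bounded :: "(nat \<Rightarrow> real) \<Rightarrow> bool" where
  "geom_bounded s \<longleftrightarrow> (\<exists>A C. \<forall>k. \<bar>s k\<bar> \<le> A * C ^ k)"

lemma geom_bounded_shift:
  assumes "geom_bounded s"
  shows "geom_bounded (\<lambda>k. s (k + i))"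
proof -
  obtain A C where "\<bar>s k\<bar> \<le> A * C ^ k" for k
    using assms unfolding geom_bounded_def by blast
  then have "\<bar>s (k + i)\<bar> \<le> (A * C ^ i) * C ^ k" for k
    by (metis mult.assoc mult.commute power_add)
  then show ?thesis unfolding geom_bounded_def by blast
qed

text \<open>The index \<open>i\<close> is the order of differentiation, see \<open>egf_deriv\<close>.\<close>

definition egf :: "nat \<Rightarrow> (nat \<Rightarrow> real) \<Rightarrow> 'a::{real_normed_field,banach} \<Rightarrow> 'a" where
  "egf i s z = (\<Sum>k. of_real (s (k + i) / fact k) * z ^ k)"

lemma egf_summable:
  fixes z :: "'a::{real_normed_field,banach}"
  assumes "geom_bounded s"
  shows "summable (\<lambda>k. of_real (s (k + i) / fact k) * z ^ k)"
proof -
  obtain A C where AC: "\<bar>s (k + i)\<bar> \<le> A * C ^ k" for k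
    using geom_bounded_shift[OF assms] unfolding geom_bounded_def by blast
  have "summable (\<lambda>k. A * (inverse (fact k) * (C * norm z) ^ k))"
    by (intro summable_mult summable_exp)
  moreover have "norm (of_real (s (k + i) / fact k) * z ^ k) \<le> A * (inverse (fact k) * (C * norm z) ^ k)" for k
  proof -
    have "norm (of_real (s (k + i) / fact k) * z ^ k) = \<bar>s (k + i)\<bar> * (inverse (fact k) * norm z ^ k)"
      by (simp add: norm_mult norm_power norm_divide divide_inverse norm_inverse norm_fact)
    also have "\<dots> \<le> A * C ^ k * (inverse (fact k) * norm z ^ k)"
      by (intro mult_right_mono AC) simp
    finally show ?thesis by (simp add: power_mult_distrib mult_ac)
  qed
  ultimately show ?thesis
    using summable_comparison_test[of "\<lambda>k. of_real (s (k + i) / fact k) * z ^ k"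
        "\<lambda>k. A * (inverse (fact k) * (C * norm z) ^ k)"] by blast
qed

text \<open>Termwise differentiation cancels one factor of the factorial, which shifts the sequence
  by one.\<close>

lemma egf_deriv:
  fixes z :: "'a::{real_normed_field,banach}"
  assumes "geom_bounded s"
  shows "(egf i s has_field_derivative egf (Suc i) s z) (at z)"
proof -
  have "real (Suc k) * (s (Suc k + i) / fact (Suc k)) = s (k + Suc i) / fact k" for k
    by (simp del: of_nat_Suc)
  then have "diffs (\<lambda>k. of_real (s (k + i) / fact k) :: 'a) = (\<lambda>k. of_real (s (k + Suc i) / fact k))"
    unfolding diffs_def by (metis of_real_mult of_real_of_nat_eq)
  then show ?thesis
    using termdiffs_strong_converges_everywhere[OF egf_summable[OF assms, of i], of z]
    unfolding egf_def[abs_def] by metis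
qed

lemma egf_at_0: "egf i s 0 = of_real (s i)"
  unfolding egf_def by (subst powser_zero) simp

text \<open>The differential equation lives over the reals, the isolation of zeros over the complex
  numbers; this links the two readings of \<open>egf\<close>.\<close>

lemma egf_of_real:
  assumes "geom_bounded s"
  shows "(egf i s (of_real t) :: 'a::{real_normed_field,banach}) = of_real (egf i s t)"
  unfolding egf_def
  using bounded_linear.suminf[OF bounded_linear_of_real[where ?'a = 'a] egf_summable[OF assms, of i t]]
  by simp

lemma egf_sum:
  assumes "\<And>j. j \<in> J \<Longrightarrow> geom_bounded (s j)"
  shows "egf i (\<lambda>k. \<Sum>j\<in>J. c j * s j k) z = (\<Sum>j\<in>J. of_real (c j) * egf i (s j) z)"
proof -
  have "egf i (\<lambda>k. \<Sum>j\<in>J. c j * s j k) z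
      = (\<Sum>k. \<Sum>j\<in>J. of_real (c j) * (of_real (s j (k + i) / fact k) * z ^ k))"
    unfolding egf_def
    by (intro suminf_cong) (simp add: sum_divide_distrib sum_distrib_right mult.assoc)
  also have "\<dots> = (\<Sum>j\<in>J. \<Sum>k. of_real (c j) * (of_real (s j (k + i) / fact k) * z ^ k))"
    using assms by (intro suminf_sum summable_mult egf_summable)
  also have "\<dots> = (\<Sum>j\<in>J. of_real (c j) * egf i (s j) z)"
    unfolding egf_def using assms by (intro sum.cong suminf_mult egf_summable refl)
  finally show ?thesis .
qed

subsection \<open>Linear recurrences\<close>

definition recurrent :: "(nat \<Rightarrow> real) \<Rightarrow> nat \<Rightarrow> (nat \<Rightarrow> real) \<Rightarrow> bool" where
  "recurrent p N s \<longleftrightarrow> (\<forall>k. s (k + N) = (\<Sum>m<N. p m * s (k + m)))"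

lemma recurrent_geom_bounded:
  assumes "recurrent p N s"
  shows "geom_bounded s"
proof -
  \<comment> \<open>\<open>A\<close> bounds the initial values. As \<open>C \<ge> 1\<close>, the
    \<open>N\<close> preceding terms are all at most \<open>A * C ^ (k - 1)\<close>, and the
    recurrence multiplies this bound by \<open>C - 1\<close>.\<close>
  define C where "C = 1 + (\<Sum>m<N. \<bar>p m\<bar>)"
  define A where "A = (\<Sum>m<N. \<bar>s m\<bar>)"
  have C: "C \<ge> 1" and A: "A \<ge> 0" by (simp_all add: C_def A_def sum_nonneg)
  have "\<bar>s k\<bar> \<le> A * C ^ k" for k
  proof (induction k rule: less_induct)
    case (less k)
    show ?case
    proof (cases "k < N")
      case True
      have "\<bar>s k\<bar> \<le> A"
        unfolding A_def using True by (intro member_le_sum) auto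
      also have "\<dots> \<le> A * C ^ k"
        using mult_left_mono[OF one_le_power[OF C, of k] A] by simp
      finally show ?thesis .
    next
      case False
      then obtain l where l: "k = l + N" by (metis add.commute le_Suc_ex not_less)
      have "\<bar>s k\<bar> \<le> (\<Sum>m<N. \<bar>p m * s (l + m)\<bar>)"
        using assms sum_abs unfolding recurrent_def l by metis
      also have "\<dots> \<le> (\<Sum>m<N. \<bar>p m\<bar> * (A * C ^ (k - 1)))"
      proof (intro sum_mono)
        fix m assume m: "m \<in> {..<N}"
        have "\<bar>s (l + m)\<bar> \<le> A * C ^ (l + m)" using less.IH[of "l + m"] m l by simp
        also have "\<dots> \<le> A * C ^ (k - 1)"
          using m l by (intro mult_left_mono power_increasing C A) auto
        finally show "\<bar>p m * s (l + m)\<bar> \<le> \<bar>p m\<bar> * (A * C ^ (k - 1))"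
          by (simp add: abs_mult mult_left_mono)
      qed
      also have "\<dots> = (C - 1) * (A * C ^ (k - 1))"
        by (simp add: C_def sum_distrib_right)
      also have "\<dots> \<le> C * (A * C ^ (k - 1))"
        using A C by (intro mult_right_mono) auto
      finally have "\<bar>s k\<bar> \<le> C * (A * C ^ (k - 1))" .
      then show ?thesis
      \<comment> \<open>Truncated subtraction spoils the bound at \<open>k = 0\<close>; but then
        \<open>N = 0\<close>, and the recurrence makes the term vanish.\<close>
      proof (cases "k = 0")
        case True
        then have "N = 0" using l by simp
        then have "s k = 0" using assms True by (simp add: recurrent_def)
        then show ?thesis using A C by simp
      qed (cases k; auto simp: mult_ac)
    qed
  qed
  then show ?thesis unfolding geom_bounded_def by blast
qed

lemma recurrent_eq:
  assumes "recurrent p N s" "recurrent p N s'" "\<And>k. k < N \<Longrightarrow> s k = s' k"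
  shows "s = s'"
proof
  fix k show "s k = s' k"
  proof (induction k rule: less_induct)
    case (less k)
    show ?case
    proof (cases "k < N")
      case False
      then obtain l where l: "k = l + N" by (metis add.commute le_Suc_ex not_less)
      then show ?thesis using assms(1,2) less by (simp add: recurrent_def)
    qed (use assms(3) in simp)
  qed
qed

text \<open>Existence counterpart of \<open>recurrent_eq\<close>: any first \<open>N\<close> values
  extend to a recurrent sequence.\<close>

fun lin_rec :: "(nat \<Rightarrow> real) \<Rightarrow> nat \<Rightarrow> (nat \<Rightarrow> real) \<Rightarrow> nat \<Rightarrow> real" where
  "lin_rec p N c k = (if k < N then c k else (\<Sum>m<N. p m * lin_rec p N c (k - N + m)))"

declare lin_rec.simps [simp del]

lemma lin_rec_init: "k < N \<Longrightarrow> lin_rec p N c k = c k"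
  by (simp add: lin_rec.simps)

lemma recurrent_lin_rec: "recurrent p N (lin_rec p N c)"
  unfolding recurrent_def by (subst lin_rec.simps) simp

lemma recurrent_sum:
  assumes "\<And>j. j \<in> J \<Longrightarrow> recurrent p N (s j)"
  shows "recurrent p N (\<lambda>k. \<Sum>j\<in>J. c j * s j k)"
  unfolding recurrent_def
proof
  fix k
  have "(\<Sum>j\<in>J. c j * s j (k + N)) = (\<Sum>j\<in>J. \<Sum>m<N. p m * (c j * s j (k + m)))"
    using assms unfolding recurrent_def
    by (intro sum.cong refl) (simp add: sum_distrib_left mult.left_commute)
  also have "\<dots> = (\<Sum>m<N. p m * (\<Sum>j\<in>J. c j * s j (k + m)))"
    by (subst sum.swap) (simp add: sum_distrib_left)
  finally show "(\<Sum>j\<in>J. c j * s j (k + N)) = (\<Sum>m<N. p m * (\<Sum>j\<in>J. c j * s j (k + m)))" .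
qed

text \<open>Differentiation shifts the sequence, so a recurrence for the coefficients is a
  differential equation for the function, with the same \<open>p\<close>.\<close>

lemma egf_recurrent:
  assumes "recurrent p N s"
  shows "egf N s t = (\<Sum>m<N. of_real (p m) * egf m s t)"
proof -
  have shift: "egf 0 (\<lambda>k. s (k + m)) t = egf m s t" for m
    by (simp add: egf_def)
  have "egf N s t = egf 0 (\<lambda>k. \<Sum>m<N. p m * s (k + m)) t"
    using assms shift[of N] by (simp add: recurrent_def)
  also have "\<dots> = (\<Sum>m<N. of_real (p m) * egf 0 (\<lambda>k. s (k + m)) t)"
    by (intro egf_sum geom_bounded_shift recurrent_geom_bounded[OF assms])
  finally show ?thesis by (simp add: shift)
qed

subsection \<open>Linear differential equations\<close>

text \<open>The sum of squares \<open>W\<close> satisfies \<open>W' \<le> K W\<close>, so \<open>W t * exp (- K * t)\<close> is nonincreasing.\<close>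

lemma linear_ode_unique:
  fixes Y :: "nat \<Rightarrow> real \<Rightarrow> real"
  assumes deriv: "\<And>k t. k < N \<Longrightarrow> t \<in> {0..T} \<Longrightarrow> (Y k has_real_derivative Y (Suc k) t) (at t within {0..T})"
    and ode: "\<And>t. t \<in> {0..T} \<Longrightarrow> Y N t = (\<Sum>m<N. p m * Y m t)"
    and init: "\<And>k. k < N \<Longrightarrow> Y k 0 = 0"
    and k: "k < N" and t: "t \<in> {0..T}"
  shows "Y k t = 0"
proof -
  define W where "W = (\<lambda>t. \<Sum>k<N. (Y k t)\<^sup>2)"
  \<comment> \<open>The summand 1 serves the products with \<open>Suc i < N\<close> in
    \<open>bound\<close>; the sum serves \<open>Suc i = N\<close>, where the equation replaces
    \<open>Y N\<close>.\<close>
  define P where "P = 1 + (\<Sum>m<N. \<bar>p m\<bar>)"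
  define K where "K = real N * (2 * P)"
  define W' where "W' = (\<lambda>t. \<Sum>k<N. 2 * (Y k t * Y (Suc k) t))"
  have P: "P \<ge> 1" by (simp add: P_def sum_nonneg)
  have W0: "W s \<ge> 0" for s by (simp add: W_def sum_nonneg)
  have prod: "\<bar>Y i s * Y j s\<bar> \<le> W s" if "i < N" "j < N" for i j s
  proof -
    have *: "(Y i s)\<^sup>2 \<le> W s" if "i < N" for i
      unfolding W_def using that by (intro member_le_sum) auto
    have "\<bar>Y i s\<bar> * \<bar>Y j s\<bar> \<le> sqrt (W s) * sqrt (W s)"
      using *[OF that(1)] *[OF that(2)] by (intro mult_mono) (auto intro: real_le_rsqrt simp: W0)
    then show ?thesis using W0[of s] by (simp add: abs_mult)
  qed
  have bound: "Y i s * Y (Suc i) s \<le> P * W s" if "i < N" "s \<in> {0..T}" for i s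
  proof (cases "Suc i = N")
    case True
    have "Y i s * Y (Suc i) s = (\<Sum>m<N. p m * (Y i s * Y m s))"
      using ode[OF that(2)] True by (simp add: sum_distrib_left mult.left_commute)
    also have "\<dots> \<le> (\<Sum>m<N. \<bar>p m\<bar> * W s)"
    proof (intro sum_mono)
      fix m assume "m \<in> {..<N}"
      then have "\<bar>p m\<bar> * \<bar>Y i s * Y m s\<bar> \<le> \<bar>p m\<bar> * W s"
        using prod that by (intro mult_left_mono) auto
      then show "p m * (Y i s * Y m s) \<le> \<bar>p m\<bar> * W s"
        by (simp flip: abs_mult)
    qed
    also have "\<dots> \<le> P * W s"
      using W0[of s] by (simp add: P_def distrib_right sum_distrib_right)
    finally show ?thesis .
  next
    case False
    then have "Y i s * Y (Suc i) s \<le> W s"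
      using prod[of i "Suc i" s] that by simp
    also have "\<dots> \<le> P * W s"
      using mult_right_mono[OF P W0[of s]] by simp
    finally show ?thesis .
  qed
  have W'_le: "W' s \<le> K * W s" if "s \<in> {0..T}" for s
  proof -
    have "W' s \<le> (\<Sum>k<N. 2 * (P * W s))"
      unfolding W'_def using bound that by (intro sum_mono) auto
    then show ?thesis by (simp add: K_def mult_ac)
  qed
  have dW: "(W has_real_derivative W' s) (at s within {0..T})" if "s \<in> {0..T}" for s
    unfolding W_def W'_def
  proof (rule DERIV_sum)
    fix k assume "k \<in> {..<N}"
    then show "((\<lambda>s. (Y k s)\<^sup>2) has_real_derivative 2 * (Y k s * Y (Suc k) s)) (at s within {0..T})"
      using DERIV_power[OF deriv[OF _ that], of k 2] by (simp add: mult.commute)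
  qed
  define V where "V = (\<lambda>s. W s * exp (- K * s))"
  have dV: "(V has_real_derivative (W' s - K * W s) * exp (- K * s)) (at s within {0..T})"
    if "s \<in> {0..T}" for s
  proof -
    have "((\<lambda>s. exp (- K * s)) has_real_derivative - K * exp (- K * s)) (at s within {0..T})"
      by (auto intro!: derivative_eq_intros)
    from DERIV_mult[OF dW[OF that] this] show ?thesis
      unfolding V_def by (simp add: algebra_simps)
  qed
  have "V t \<le> V 0"
  \<comment> \<open>At the end points only one-sided derivatives are given; this criterion asks for
    continuity there and for two-sided derivatives inside.\<close>
  proof (rule DERIV_nonpos_imp_decreasing_open[of 0 t V])
    show "0 \<le> t" using t by simp
    have "continuous_on {0..T} V"
      by (rule DERIV_continuous_on[OF dV])
    then show "continuous_on {0..t} V"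
      by (rule continuous_on_subset) (use t in auto)
    fix s assume s: "0 < s" "s < t"
    then have s': "s \<in> {0..T}" and at: "at s within {0..T} = at s"
      using t by (simp_all add: at_within_Icc_at)
    have "(W' s - K * W s) * exp (- K * s) \<le> 0"
      using W'_le[OF s'] by (simp add: mult_le_0_iff)
    then show "\<exists>y. (V has_real_derivative y) (at s) \<and> y \<le> 0"
      using dV[OF s'] unfolding at by blast
  qed
  also have "V 0 = 0" using init by (simp add: V_def W_def)
  finally have "W t \<le> 0" by (simp add: V_def mult_le_0_iff)
  then have "(\<Sum>k<N. (Y k t)\<^sup>2) = 0" using W0[of t] by (simp add: W_def)
  then show ?thesis using k by (subst (asm) sum_nonneg_eq_0_iff) auto
qed

text \<open>Rolle on each gap between consecutive zeros. The new zeros lie in successive gaps, hence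
  increase again, and the argument can be iterated.\<close>

lemma Rolle_chain:
  fixes f :: "real \<Rightarrow> real"
  assumes "\<And>t. (f has_real_derivative f' t) (at t)"
    and "\<And>i. i \<le> m \<Longrightarrow> f (z i) = 0" and "\<And>i. i < m \<Longrightarrow> z i < z (Suc i)"
  obtains w where "\<And>i. i < m \<Longrightarrow> z i < w i \<and> w i < z (Suc i) \<and> f' (w i) = 0"
proof -
  have "\<exists>w. z i < w \<and> w < z (Suc i) \<and> f' w = 0" if "i < m" for i
  proof -
    have "\<exists>w. z i < w \<and> w < z (Suc i) \<and> DERIV f w :> 0"
      using assms that
      by (intro Rolle) (auto intro!: continuous_at_imp_continuous_on DERIV_isCont
          simp: real_differentiable_def)
    then show ?thesis using DERIV_unique assms(1) by blast
  qed
  then show ?thesis using that by metis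
qed

text \<open>
  Counted with multiplicity, \<open>Y 0\<close> has \<open>2 * n\<close> zeros in \<open>{0..T}\<close>, so each of its first \<open>2 * n - 1\<close>
  derivatives has a zero there by Rolle.
\<close>

lemma derivatives_have_zero:
  fixes Y :: "nat \<Rightarrow> real \<Rightarrow> real"
  assumes deriv: "\<And>k t. (Y k has_real_derivative Y (Suc k) t) (at t)"
    and zero: "\<And>i. i < n \<Longrightarrow> Y i 0 = 0" "\<And>i. i < n \<Longrightarrow> Y i T = 0"
    and T: "T > 0" and k: "k < 2 * n"
  obtains t where "t \<in> {0..T}" "Y k t = 0"
proof (cases "k < n")
  case True
  then show ?thesis using zero(1)[of k] T that[of 0] by auto
next
  case False
  \<comment> \<open>\<open>Z m k\<close>: the function \<open>Y k\<close> has \<open>m\<close>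
    distinct zeros in the open interval, listed increasingly.\<close>
  define Z where "Z m k \<longleftrightarrow> (\<exists>z. (\<forall>i<m. z i \<in> {0<..<T} \<and> Y k (z i) = 0) \<and>
      (\<forall>i. Suc i < m \<longrightarrow> z i < z (Suc i)))" for m k
  \<comment> \<open>Up to order \<open>n\<close> each derivative gains a zero: \<open>k\<close>
    interior ones framed by the end points are \<open>k + 2\<close> zeros, and Rolle leaves
    \<open>k + 1\<close>.\<close>
  have up: "Z k k" if "k \<le> n" for k
    using that
  proof (induction k)
    case 0
    then show ?case by (simp add: Z_def)
  next
    case (Suc k)
    then obtain z where z: "\<And>i. i < k \<Longrightarrow> z i \<in> {0<..<T} \<and> Y k (z i) = 0"
      "\<And>i. Suc i < k \<Longrightarrow> z i < z (Suc i)"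
      unfolding Z_def by auto
    define z' where "z' i = (if i = 0 then 0 else if i \<le> k then z (i - 1) else T)" for i
    have z': "z' i \<in> {0..T} \<and> Y k (z' i) = 0" for i
      using z(1)[of "i - 1"] zero[of k] Suc.prems T by (cases i) (auto simp: z'_def)
    have z'': "z' i < z' (Suc i)" if "i < Suc k" for i
    proof (cases i)
      case 0
      then show ?thesis using z(1)[of 0] T by (simp add: z'_def)
    next
      case (Suc l)
      then show ?thesis using z(1)[of l] z(2)[of l] that by (simp add: z'_def)
    qed
    obtain w where w: "\<And>i. i < Suc k \<Longrightarrow> z' i < w i \<and> w i < z' (Suc i) \<and> Y (Suc k) (w i) = 0"
      by (rule Rolle_chain[of "Y k" "Y (Suc k)" "Suc k" z']) (use deriv z' z'' in auto)
    have "w i \<in> {0<..<T}" if "i < Suc k" for i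
      using w[OF that] z'[of i] z'[of "Suc i"] by auto
    moreover have "w i < w (Suc i)" if "Suc i < Suc k" for i
      using w[of i] w[of "Suc i"] that by force
    ultimately show ?case unfolding Z_def using w by blast
  qed
  \<comment> \<open>From order \<open>n\<close> on the end points no longer contribute, so each
    derivative loses one zero; \<open>2 * n - k\<close> remain at order \<open>k\<close>.\<close>
  have down: "Z (n - d) (n + d)" if "d \<le> n" for d
    using that
  proof (induction d)
    case 0
    then show ?case using up[of n] by simp
  next
    case (Suc d)
    define m where "m = n - Suc d"
    have m: "n - d = Suc m" using Suc.prems by (simp add: m_def)
    from Suc obtain z where z: "\<And>i. i < Suc m \<Longrightarrow> z i \<in> {0<..<T} \<and> Y (n + d) (z i) = 0"
      "\<And>i. Suc i < Suc m \<Longrightarrow> z i < z (Suc i)"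
      unfolding Z_def m by auto
    obtain w where w: "\<And>i. i < m \<Longrightarrow> z i < w i \<and> w i < z (Suc i) \<and> Y (Suc (n + d)) (w i) = 0"
      by (rule Rolle_chain[of "Y (n + d)" "Y (Suc (n + d))" m z]) (use deriv z in auto)
    have "w i \<in> {0<..<T}" if "i < m" for i
      using w[OF that] z(1)[of i] z(1)[of "Suc i"] that by force
    moreover have "w i < w (Suc i)" if "Suc i < m" for i
      using w[of i] w[of "Suc i"] that by force
    ultimately show ?case unfolding Z_def m_def[symmetric] using w by auto
  qed
  have "Z (n - (k - n)) k" "0 < n - (k - n)" using down[of "k - n"] False k by auto
  then show ?thesis using that unfolding Z_def by (metis atLeastAtMost_iff greaterThanLessThan_iff less_imp_le)
qed

lemma linear_ode_zero_if_derivatives_have_zero: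
  fixes Y :: "nat \<Rightarrow> real \<Rightarrow> real"
  assumes deriv: "\<And>k t. (Y k has_real_derivative Y (Suc k) t) (at t)"
    and ode: "\<And>t. Y N t = (\<Sum>m<N. p m * Y m t)"
    and zero: "\<And>k. k < N \<Longrightarrow> \<exists>t\<in>{0..T}. Y k t = 0"
    and T: "0 < T" "T \<le> 1" "T * (\<Sum>m<N. \<bar>p m\<bar>) < 1"
    and k: "k < N" and t: "t \<in> {0..T}"
  shows "Y k t = 0"
proof -
  have "continuous_on {0..T} (\<lambda>t. \<bar>Y N t\<bar>)"
    by (intro continuous_intros continuous_at_imp_continuous_on ballI DERIV_isCont[OF deriv])
  then obtain t0 where t0: "t0 \<in> {0..T}" "\<And>t. t \<in> {0..T} \<Longrightarrow> \<bar>Y N t\<bar> \<le> \<bar>Y N t0\<bar>"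
    using continuous_attains_sup[of "{0..T}" "\<lambda>t. \<bar>Y N t\<bar>"] T(1) by auto
  define M where "M = \<bar>Y N t0\<bar>"
  have M: "M \<ge> 0" by (simp add: M_def)
  have step: "\<bar>Y k t\<bar> \<le> T * M"
    if k: "k < N" and t: "t \<in> {0..T}" and M_bound: "\<And>t. t \<in> {0..T} \<Longrightarrow> \<bar>Y (Suc k) t\<bar> \<le> M" for k t
  proof -
    obtain s where s: "s \<in> {0..T}" "Y k s = 0" using zero[OF k] by blast
    have "norm (Y k t - Y k s) \<le> M * norm (t - s)"
      using t M_bound s
      by (intro field_differentiable_bound[of "{0..T}" "Y k" "Y (Suc k)"])
        (auto intro: has_field_derivative_at_within deriv)
    also have "\<dots> \<le> M * T" using t s M by (intro mult_left_mono) auto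
    finally show ?thesis using s by (simp add: mult.commute)
  qed
  \<comment> \<open>Induction from order \<open>N - 1\<close> downwards; \<open>T \<le> 1\<close>
    weakens the bound \<open>T * M\<close> on \<open>Y (Suc k)\<close> to the bound \<open>M\<close>
    that \<open>step\<close> takes.\<close>
  have bound: "\<bar>Y k t\<bar> \<le> T * M" if "k < N" "t \<in> {0..T}" for k t
    using that
  proof (induction "N - Suc k" arbitrary: k t)
    case 0
    then have "Suc k = N" by simp
    with 0 t0 show ?case by (intro step) (auto simp: M_def)
  next
    case (Suc d)
    show ?case
    proof (rule step[OF Suc.prems])
      fix s assume "s \<in> {0..T}"
      then have "\<bar>Y (Suc k) s\<bar> \<le> T * M" using Suc by (intro Suc.hyps(1)) auto
      also have "\<dots> \<le> M" using mult_right_mono[OF T(2) M] by simp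
      finally show "\<bar>Y (Suc k) s\<bar> \<le> M" .
    qed
  qed
  \<comment> \<open>Evaluating the equation where the top derivative is largest bounds
    \<open>M\<close> by itself times a factor below 1.\<close>
  have "M \<le> (\<Sum>m<N. \<bar>p m * Y m t0\<bar>)"
    unfolding M_def ode by (rule sum_abs)
  also have "\<dots> \<le> (\<Sum>m<N. \<bar>p m\<bar> * (T * M))"
    using bound t0(1) by (intro sum_mono) (auto simp: abs_mult intro!: mult_left_mono)
  also have "\<dots> = (T * (\<Sum>m<N. \<bar>p m\<bar>)) * M"
    by (simp add: sum_distrib_right sum_distrib_left mult_ac)
  finally have "(1 - T * (\<Sum>m<N. \<bar>p m\<bar>)) * M \<le> 0" by (simp add: algebra_simps)
  then have "M = 0" using T(3) M by (simp add: mult_le_0_iff)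
  then show ?thesis using bound[OF k t] by simp
qed

subsection \<open>Two-point boundary value problems\<close>

lemma mat_mult_vec_nth:
  fixes A :: "nat \<Rightarrow> nat \<Rightarrow> 'a::comm_ring_1"
  assumes "w \<in> carrier_vec n" "i < n"
  shows "vec_index (Matrix.mat n n (\<lambda>(i,j). A i j) *\<^sub>v w) i = (\<Sum>j<n. A i j * vec_index w j)"
  using assms by (simp add: scalar_prod_def atLeast0LessThan)

lemma det_nonzero_solvable:
  fixes A :: "nat \<Rightarrow> nat \<Rightarrow> 'a::field"
  assumes "Determinant.det (Matrix.mat n n (\<lambda>(i,j). A i j)) \<noteq> 0"
  obtains c where "\<And>i. i < n \<Longrightarrow> (\<Sum>j<n. A i j * c j) = d i"
proof -
  let ?A = "Matrix.mat n n (\<lambda>(i,j). A i j)"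
  have A: "?A \<in> carrier_mat n n" by simp
  \<comment> \<open>The argument \<open>()\<close> fills the extension slot of the matrix ring
    record.\<close>
  from det_non_zero_imp_unit[OF A assms, of "()"]
  obtain B where B: "?A * B = 1\<^sub>m n" "B \<in> carrier_mat n n"
    unfolding Units_def ring_mat_def by auto
  define w where "w = B *\<^sub>v Matrix.vec n d"
  have w: "w \<in> carrier_vec n" using B(2) by (simp add: w_def)
  have "?A *\<^sub>v w = (?A * B) *\<^sub>v Matrix.vec n d"
    unfolding w_def using A B(2) by (intro assoc_mult_mat_vec[symmetric]) auto
  then have "?A *\<^sub>v w = Matrix.vec n d" by (simp add: B(1))
  then have "(\<Sum>j<n. A i j * vec_index w j) = d i" if "i < n" for i
    using mat_mult_vec_nth[OF w that, of A] that by simp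
  then show ?thesis using that by blast
qed

text \<open>From right to left it shows that the boundary determinant is nonzero at a small time;
  from left to right it gives uniqueness.\<close>

lemma det_nonzero_iff_kernel:
  fixes A :: "nat \<Rightarrow> nat \<Rightarrow> 'a::field"
  shows "Determinant.det (Matrix.mat n n (\<lambda>(i,j). A i j)) \<noteq> 0 \<longleftrightarrow>
    (\<forall>c. (\<forall>i<n. (\<Sum>j<n. A i j * c j) = 0) \<longrightarrow> (\<forall>j<n. c j = 0))"
proof -
  let ?A = "Matrix.mat n n (\<lambda>(i,j). A i j)"
  have A: "?A \<in> carrier_mat n n" by simp
  have eq: "?A *\<^sub>v w = 0\<^sub>v n \<longleftrightarrow> (\<forall>i<n. (\<Sum>j<n. A i j * vec_index w j) = 0)"
    if "w \<in> carrier_vec n" for w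
    using mat_mult_vec_nth[OF that, of _ A] by (auto simp: vec_eq_iff)
  show ?thesis
  proof
    assume det: "Determinant.det ?A \<noteq> 0"
    show "\<forall>c. (\<forall>i<n. (\<Sum>j<n. A i j * c j) = 0) \<longrightarrow> (\<forall>j<n. c j = 0)"
    proof (intro allI impI)
      fix c j assume c: "\<forall>i<n. (\<Sum>j<n. A i j * c j) = 0" and j: "j < n"
      have "?A *\<^sub>v Matrix.vec n c = 0\<^sub>v n" using c by (subst eq) auto
      then have "Matrix.vec n c = 0\<^sub>v n"
        using det det_0_iff_vec_prod_zero_field[OF A] by (metis vec_carrier)
      then show "c j = 0" using j by (metis index_vec index_zero_vec(1))
    qed
  next
    assume ker: "\<forall>c. (\<forall>i<n. (\<Sum>j<n. A i j * c j) = 0) \<longrightarrow> (\<forall>j<n. c j = 0)"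
    show "Determinant.det ?A \<noteq> 0"
    proof
      assume "Determinant.det ?A = 0"
      then obtain w where w: "w \<in> carrier_vec n" "w \<noteq> 0\<^sub>v n" "?A *\<^sub>v w = 0\<^sub>v n"
        using det_0_iff_vec_prod_zero_field[OF A] by blast
      then have "\<forall>j<n. vec_index w j = 0" using eq[OF w(1)] ker by blast
      then show False using w by (auto simp: vec_eq_iff)
    qed
  qed
qed

section \<open>Fundamental solutions and the boundary determinant\<close>

definition fund :: "(nat \<Rightarrow> real) \<Rightarrow> nat \<Rightarrow> nat \<Rightarrow> nat \<Rightarrow> real" where
  "fund p N j = lin_rec p N (\<lambda>k. if k = j then 1 else 0)"

lemma recurrent_fund: "recurrent p N (fund p N j)"
  unfolding fund_def by (rule recurrent_lin_rec)

lemma fund_init: "k < N \<Longrightarrow> fund p N j k = (if k = j then 1 else 0)"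
  by (simp add: fund_def lin_rec_init)

text \<open>The fundamental sequences have unit initial data, so the coefficients are the initial
  values of \<open>s\<close>. The split at \<open>n\<close> separates the values prescribed at 0
  from the free ones.\<close>

lemma egf_fund_expand:
  assumes "recurrent p (2 * n) s"
  shows "egf i s z = (\<Sum>j<n. egf i (fund p (2 * n) j) z * of_real (s j))
    + (\<Sum>j<n. egf i (fund p (2 * n) (n + j)) z * of_real (s (n + j)))"
proof -
  have split: "(\<Sum>j<n + m. f j) = (\<Sum>j<n. f j) + (\<Sum>j<m. f (n + j))"
    for f :: "nat \<Rightarrow> 'a" and m
    by (induction m) (simp_all add: add.assoc)
  have "s = (\<lambda>k. \<Sum>j<2 * n. s j * fund p (2 * n) j k)"
    by (intro recurrent_eq[OF assms] recurrent_sum recurrent_fund)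
      (simp add: fund_init if_distrib[of "(*) _"] sum.delta cong: if_cong)
  then have "egf i s z = egf i (\<lambda>k. \<Sum>j<2 * n. s j * fund p (2 * n) j k) z"
    by simp
  also have "\<dots> = (\<Sum>j<2 * n. egf i (fund p (2 * n) j) z * of_real (s j))"
    by (subst egf_sum) (auto intro: recurrent_geom_bounded recurrent_fund simp: mult.commute)
  finally show ?thesis using split[where m = n] by (simp add: mult_2)
qed

text \<open>
  The determinant of the map that sends the \<open>n\<close> free derivatives at \<open>0\<close> of a solution vanishing to
  order \<open>n\<close> at \<open>0\<close> to its first \<open>n\<close> derivatives at \<open>z\<close>.
\<close>

definition bvp_det :: "(nat \<Rightarrow> real) \<Rightarrow> nat \<Rightarrow> 'a::{real_normed_field,banach} \<Rightarrow> 'a" where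
  "bvp_det p n z =
     Determinant.det (Matrix.mat n n (\<lambda>(i,j). egf i (fund p (2 * n) (n + j)) z))"

text \<open>The Leibniz formula exhibits a finite sum of products of entire functions, from which
  holomorphy and compatibility with \<open>of_real\<close> are read off.\<close>

lemma bvp_det_expand:
  "bvp_det p n z = (\<Sum>\<pi> | \<pi> permutes {0..<n}.
     signof \<pi> * (\<Prod>i = 0..<n. egf i (fund p (2 * n) (n + \<pi> i)) z))"
proof -
  have "bvp_det p n z = (\<Sum>\<pi> | \<pi> permutes {0..<n}.
     signof \<pi> * (\<Prod>i = 0..<n. Matrix.mat n n (\<lambda>(i,j). egf i (fund p (2 * n) (n + j)) z) $$ (i, \<pi> i)))"
    unfolding bvp_det_def by (rule det_def') simp
  also have "\<dots> = (\<Sum>\<pi> | \<pi> permutes {0..<n}.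
     signof \<pi> * (\<Prod>i = 0..<n. egf i (fund p (2 * n) (n + \<pi> i)) z))"
    by (intro sum.cong prod.cong refl arg_cong2[of _ _ _ _ "(*)"])
      (auto dest: permutes_in_image)
  finally show ?thesis .
qed

lemma bvp_det_of_real: "bvp_det p n (of_real t) = of_real (bvp_det p n t)"
  by (simp add: bvp_det_expand egf_of_real[OF recurrent_geom_bounded[OF recurrent_fund]])

lemma bvp_det_holomorphic: "bvp_det p n holomorphic_on UNIV"
proof -
  have "egf i (fund p (2 * n) j) holomorphic_on UNIV" for i j
    using egf_deriv[OF recurrent_geom_bounded[OF recurrent_fund[of p "2 * n" j]], of i]
    unfolding holomorphic_on_open[OF open_UNIV] by blast
  then show ?thesis
    unfolding bvp_det_expand[abs_def]
    by (intro holomorphic_on_sum holomorphic_on_mult holomorphic_on_prod holomorphic_on_const)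
qed

text \<open>One such point keeps the entire function from vanishing identically.\<close>

lemma bvp_det_nonzero:
  obtains T :: real where "bvp_det p n T \<noteq> 0"
proof -
  define P where "P = (\<Sum>m<2 * n. \<bar>p m\<bar>)"
  \<comment> \<open>Chosen so that \<open>T \<le> 1\<close> and \<open>T * P < 1\<close>.\<close>
  define T where "T = 1 / (1 + P)"
  have "P \<ge> 0" by (simp add: P_def sum_nonneg)
  then have T: "0 < T" "T \<le> 1" "T * P < 1" by (simp_all add: T_def)
  have "c j = 0" if c: "\<forall>i<n. (\<Sum>j<n. egf i (fund p (2 * n) (n + j)) T * c j) = 0" and j: "j < n" for c j
  proof -
    \<comment> \<open>A kernel vector \<open>c\<close> is the upper half of the initial data of a
      solution that vanishes to order \<open>n\<close> at both 0 and \<open>T\<close>.\<close>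
    define s where "s k = (\<Sum>j<n. c j * fund p (2 * n) (n + j) k)" for k
    have s: "recurrent p (2 * n) s"
      unfolding s_def[abs_def] by (intro recurrent_sum recurrent_fund)
    note deriv = egf_deriv[OF recurrent_geom_bounded[OF s]]
    have init: "s k = 0" if "k < n" for k
      using that by (auto simp: s_def fund_init intro!: sum.neutral)
    have s_upper: "s (n + j) = c j" if "j < n" for j
      using that by (simp add: s_def fund_init if_distrib[of "(*) _"] sum.delta cong: if_cong)
    have at_T: "egf i s T = 0" if "i < n" for i
      using that c init s_upper by (simp add: egf_fund_expand[OF s])
    have zero: "\<exists>t\<in>{0..T}. egf k s t = 0" if "k < 2 * n" for k
      by (rule derivatives_have_zero[of "\<lambda>k. egf k s" n T k])
        (use deriv init at_T T(1) that in \<open>auto simp: egf_at_0\<close>)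
    have "egf (n + j) s (0::real) = 0"
      by (rule linear_ode_zero_if_derivatives_have_zero[where Y = "\<lambda>k. egf k s" and N = "2 * n"
            and p = p and T = T])
        (use deriv zero T j egf_recurrent[OF s, where ?'a = real] in \<open>auto simp: P_def\<close>)
    then show ?thesis using s_upper[OF j] by (simp add: egf_at_0)
  qed
  then have "bvp_det p n T \<noteq> 0"
    unfolding bvp_det_def det_nonzero_iff_kernel by blast
  then show ?thesis using that by blast
qed

text \<open>A real accumulation point of zeros would also be one in the complex plane. It is
  excluded by isolation of zeros if \<open>F\<close> vanishes there, and by continuity
  otherwise.\<close>

lemma holomorphic_real_zeros_sparse:
  assumes holo: "F holomorphic_on UNIV" and "F (complex_of_real t0) \<noteq> 0"
  shows "{t. F (complex_of_real t) = 0} sparse_in UNIV"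
  unfolding sparse_in_open[OF open_UNIV]
proof (intro ballI notI)
  fix x assume lim: "x islimpt {t. F (complex_of_real t) = 0}"
  obtain r where r: "r > 0" "\<And>z. z \<in> ball (of_real x) r - {of_real x} \<Longrightarrow> F z \<noteq> 0"
  proof (cases "F (of_real x) = 0")
    case True
    then show ?thesis
      using isolated_zeros[OF holo open_UNIV connected_UNIV, of "of_real x" "of_real t0"] assms(2) that
      by auto
  next
    case False
    have "continuous (at (of_real x)) F"
      using holomorphic_on_imp_continuous_on[OF holo] by (simp add: continuous_on_eq_continuous_at)
    from continuous_at_avoid[OF this False] that show ?thesis by (metis DiffD1 mem_ball)
  qed
  obtain t where "F (of_real t) = 0" "t \<noteq> x" "dist t x < r"
    using lim r(1) by (auto simp: islimpt_approachable)
  moreover have "dist (complex_of_real x) (of_real t) = dist t x"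
    by (simp add: dist_norm norm_minus_commute flip: of_real_diff)
  ultimately show False using r(2)[of "of_real t"] by auto
qed

lemma bvp_det_zeros_sparse: "{T :: real. bvp_det p n T = 0} sparse_in UNIV"
proof -
  obtain T0 :: real where "bvp_det p n T0 \<noteq> 0" by (rule bvp_det_nonzero)
  then have "bvp_det p n (complex_of_real T0) \<noteq> 0" by (simp add: bvp_det_of_real)
  from holomorphic_real_zeros_sparse[OF bvp_det_holomorphic this]
  show ?thesis by (simp add: bvp_det_of_real)
qed

section \<open>Solvability of the boundary value problem where the determinant is nonzero\<close>

definition ode_solution :: "(nat \<Rightarrow> real) \<Rightarrow> nat \<Rightarrow> real \<Rightarrow> (real \<Rightarrow> real) \<Rightarrow> bool" where
  "ode_solution p N T y \<longleftrightarrow> times_differentiable_on N y {0..T} \<and>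
     (\<forall>t\<in>{0..T}. nderiv {0..T} N y t = (\<Sum>m<N. p m * nderiv {0..T} m y t))"

lemma nderiv_egf:
  assumes "0 < T" "geom_bounded s" "t \<in> {0..T}"
  shows "nderiv {0..T} i (egf 0 s) t = egf i s t"
  using assms(3)
proof (induction i arbitrary: t)
  case 0
  then show ?case by (simp add: nderiv_def)
next
  case (Suc i)
  show ?case
    by (rule nderiv_Suc_eqI(2)[OF assms(1) Suc.IH _ Suc.prems])
      (auto intro: has_field_derivative_at_within egf_deriv assms(2))
qed

lemma ode_solution_egf:
  assumes "0 < T" "recurrent p N s"
  shows "ode_solution p N T (egf 0 s)"
proof -
  note s = recurrent_geom_bounded[OF assms(2)]
  have "(nderiv {0..T} k (egf 0 s) has_real_derivative egf (Suc k) s t) (at t within {0..T})"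
    if "t \<in> {0..T}" for k t
    by (rule nderiv_Suc_eqI(1)[OF assms(1) nderiv_egf[OF assms(1) s] _ that])
      (auto intro: has_field_derivative_at_within egf_deriv s)
  then have "times_differentiable_on N (egf 0 s) {0..T}"
    unfolding times_differentiable_on_def differentiable_on_def real_differentiable_def by blast
  then show ?thesis
    using egf_recurrent[OF assms(2), where ?'a = real] nderiv_egf[OF assms(1) s]
    by (simp add: ode_solution_def)
qed

text \<open>The difference solves the same linear equation with zero initial data. So every solution
  on the interval is the restriction of an entire function.\<close>

lemma ode_solution_eq_egf:
  assumes "0 < T" "ode_solution p N T y" "recurrent p N s"
    and "\<And>k. k < N \<Longrightarrow> s k = nderiv {0..T} k y 0" and "k < N" "t \<in> {0..T}"
  shows "nderiv {0..T} k y t = egf k s t"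
proof -
  have "nderiv {0..T} k y t - egf k s t = 0"
  proof (rule linear_ode_unique[where Y = "\<lambda>k t. nderiv {0..T} k y t - egf k s t"
        and N = N and T = T and p = p and k = k and t = t])
    fix k t assume k: "k < N" and t: "t \<in> {0..T}"
    have "times_differentiable_on N y {0..T}"
      using assms(2) by (simp add: ode_solution_def)
    from DERIV_diff[OF nderiv_has_real_derivative[OF this k t]
        has_field_derivative_at_within[OF egf_deriv[OF recurrent_geom_bounded[OF assms(3)]]]]
    show "((\<lambda>t. nderiv {0..T} k y t - egf k s t) has_real_derivative
        nderiv {0..T} (Suc k) y t - egf (Suc k) s t) (at t within {0..T})" .
  next
    fix t assume "t \<in> {0..T}"
    then show "nderiv {0..T} N y t - egf N s t = (\<Sum>m<N. p m * (nderiv {0..T} m y t - egf m s t))"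
      using assms(2) egf_recurrent[OF assms(3), of t]
      by (simp add: ode_solution_def right_diff_distrib sum_subtractf)
  qed (use assms in \<open>auto simp: egf_at_0\<close>)
  then show ?thesis by simp
qed

lemma bvp_exists:
  assumes T: "0 < T" and det: "bvp_det p n T \<noteq> 0"
  obtains y where "ode_solution p (2 * n) T y"
    "\<And>i. i < n \<Longrightarrow> nderiv {0..T} i y 0 = \<alpha> i" "\<And>i. i < n \<Longrightarrow> nderiv {0..T} i y T = \<beta> i"
proof -
  \<comment> \<open>The values \<open>\<alpha>\<close> fix the lower half of the initial data; their
    contribution at \<open>T\<close> is moved to the right-hand side, and \<open>c\<close> is the
    upper half.\<close>
  obtain c where c: "\<And>i. i < n \<Longrightarrow> (\<Sum>j<n. egf i (fund p (2 * n) (n + j)) T * c j)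
      = \<beta> i - (\<Sum>j<n. egf i (fund p (2 * n) j) T * \<alpha> j)"
    using det_nonzero_solvable[OF det[unfolded bvp_det_def],
        of "\<lambda>i. \<beta> i - (\<Sum>j<n. egf i (fund p (2 * n) j) T * \<alpha> j)"] by auto
  define s where "s = lin_rec p (2 * n) (\<lambda>k. if k < n then \<alpha> k else c (k - n))"
  have s: "recurrent p (2 * n) s" unfolding s_def by (rule recurrent_lin_rec)
  have init: "s j = \<alpha> j" "s (n + j) = c j" if "j < n" for j
    using that by (simp_all add: s_def lin_rec_init)
  show ?thesis
  proof (rule that)
    show "ode_solution p (2 * n) T (egf 0 s)" by (rule ode_solution_egf[OF T s])
    show "nderiv {0..T} i (egf 0 s) 0 = \<alpha> i" if "i < n" for i
      using nderiv_egf[OF T recurrent_geom_bounded[OF s]] T that init by (simp add: egf_at_0)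
    show "nderiv {0..T} i (egf 0 s) T = \<beta> i" if "i < n" for i
      using nderiv_egf[OF T recurrent_geom_bounded[OF s]] T that init c
      by (simp add: egf_fund_expand[OF s])
  qed
qed

lemma bvp_unique:
  assumes T: "0 < T" and det: "bvp_det p n T \<noteq> 0"
    and y: "ode_solution p (2 * n) T y" and z: "ode_solution p (2 * n) T z"
    and at_0: "\<And>i. i < n \<Longrightarrow> nderiv {0..T} i y 0 = nderiv {0..T} i z 0"
    and at_T: "\<And>i. i < n \<Longrightarrow> nderiv {0..T} i y T = nderiv {0..T} i z T"
    and n: "n \<ge> 1" and t: "t \<in> {0..T}"
  shows "y t = z t"
proof -
  define s where "s w = lin_rec p (2 * n) (\<lambda>k. nderiv {0..T} k w 0)" for w
  have s: "recurrent p (2 * n) (s w)" for w unfolding s_def by (rule recurrent_lin_rec)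
  have init: "s w k = nderiv {0..T} k w 0" if "k < 2 * n" for w k
    using that by (simp add: s_def lin_rec_init)
  note y_egf = ode_solution_eq_egf[OF T y s init] and z_egf = ode_solution_eq_egf[OF T z s init]
  \<comment> \<open>The lower halves of the initial data agree, so in the difference at
    \<open>T\<close> only the upper halves survive.\<close>
  have "(\<Sum>j<n. egf i (fund p (2 * n) (n + j)) T * (s y (n + j) - s z (n + j))) = 0" if "i < n" for i
  proof -
    have "egf i (s y) T = egf i (s z) T"
      using y_egf[of i T] z_egf[of i T] at_T[OF that] that T by simp
    then show ?thesis
      using at_0 init by (simp add: egf_fund_expand[OF s] right_diff_distrib sum_subtractf)
  qed
  then have upper: "s y (n + j) = s z (n + j)" if "j < n" for j
    using det[unfolded bvp_det_def det_nonzero_iff_kernel, rule_format,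
        of "\<lambda>j. s y (n + j) - s z (n + j)" j] that by auto
  have "s y k = s z k" if "k < 2 * n" for k
    using upper[of "k - n"] at_0[of k] init that by (cases "k < n") auto
  then have "s y = s z" by (rule recurrent_eq[OF s s])
  then show ?thesis
    using y_egf[of 0 t] z_egf[of 0 t] n t by (simp add: nderiv_def)
qed

subsection \<open>The Euler-Lagrange equation of a quadratic Lagrangian\<close>

text \<open>The induction differentiates terms of order below \<open>N\<close> only. For
  \<open>j \<le> n\<close> and \<open>N = 2 * n\<close> the regularity demanded of solutions is just
  enough.\<close>

lemma nderiv_lincomb:
  assumes "0 < T" "times_differentiable_on N y {0..T}" "j + n \<le> N" "t \<in> {0..T}"
  shows "nderiv {0..T} j (\<lambda>s. \<Sum>k\<le>n. C k * nderiv {0..T} k y s) t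
    = (\<Sum>k\<le>n. C k * nderiv {0..T} (k + j) y t)"
  using assms(3,4)
proof (induction j arbitrary: t)
  case 0
  then show ?case by (simp add: nderiv_def)
next
  case (Suc j)
  show ?case
  proof (rule nderiv_Suc_eqI(2)[OF assms(1) Suc.IH _ Suc.prems(2)])
    show "((\<lambda>s. \<Sum>k\<le>n. C k * nderiv {0..T} (k + j) y s) has_real_derivative
        (\<Sum>k\<le>n. C k * nderiv {0..T} (k + Suc j) y t)) (at t within {0..T})"
      using Suc.prems
      by (auto intro!: DERIV_sum DERIV_cmult nderiv_has_real_derivative[OF assms(2)])
  qed (use Suc.prems in auto)
qed

text \<open>The coefficient of the derivative of order \<open>m\<close> in the Euler-Lagrange
  expression when the \<open>j\<close>-th partial derivative of the Lagrangian is the linear form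
  with coefficients \<open>G j k\<close>.\<close>

definition el_coeff :: "nat \<Rightarrow> (nat \<Rightarrow> nat \<Rightarrow> real) \<Rightarrow> nat \<Rightarrow> real" where
  "el_coeff n G m = (\<Sum>j\<le>n. \<Sum>k\<le>n. if k + j = m then (-1) ^ j * G j k else 0)"

text \<open>For \<open>j\<close> and \<open>k\<close> at most \<open>n\<close>, the sum
  \<open>k + j\<close> reaches \<open>2 * n\<close> only when both equal \<open>n\<close>.\<close>

lemma el_coeff_top: "el_coeff n G (2 * n) = (-1) ^ n * G n n"
proof -
  have "el_coeff n G (2 * n) = (\<Sum>j\<le>n. \<Sum>k\<le>n. if k = n then (if j = n then (-1) ^ n * G n n else 0) else 0)"
    unfolding el_coeff_def by (intro sum.cong refl) auto
  then show ?thesis by (simp add: sum.delta)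
qed

lemma euler_lagrange_iff_ode:
  assumes T: "0 < T" and y: "times_differentiable_on (2 * n) y {0..T}"
    and partial: "\<And>j v. j \<le> n \<Longrightarrow> partial_deriv j L v = (\<Sum>k\<le>n. G j k * v k)"
    and G: "G n n \<noteq> 0"
  shows "euler_lagrange n L {0..T} y \<longleftrightarrow>
    ode_solution (\<lambda>m. - el_coeff n G m / el_coeff n G (2 * n)) (2 * n) T y"
proof -
  define D where "D = el_coeff n G (2 * n)"
  have D: "D \<noteq> 0" using G by (simp add: D_def el_coeff_top)
  have "(\<Sum>j\<le>n. (-1) ^ j * nderiv {0..T} j (\<lambda>s. partial_deriv j L (jet {0..T} y s)) t) = 0 \<longleftrightarrow>
    nderiv {0..T} (2 * n) y t = (\<Sum>m<2 * n. - el_coeff n G m / D * nderiv {0..T} m y t)"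
    if t: "t \<in> {0..T}" for t
  proof -
    let ?Y = "\<lambda>m. nderiv {0..T} m y t"
    have "(\<Sum>j\<le>n. (-1) ^ j * nderiv {0..T} j (\<lambda>s. partial_deriv j L (jet {0..T} y s)) t)
        = (\<Sum>j\<le>n. \<Sum>k\<le>n. (-1) ^ j * G j k * ?Y (k + j))"
    proof (intro sum.cong refl)
      fix j assume "j \<in> {..n}"
      then show "(-1) ^ j * nderiv {0..T} j (\<lambda>s. partial_deriv j L (jet {0..T} y s)) t
          = (\<Sum>k\<le>n. (-1) ^ j * G j k * ?Y (k + j))"
        using nderiv_lincomb[OF T y, of j n t "G j"] t
        by (simp add: partial jet_def sum_distrib_left mult.assoc)
    qed
    \<comment> \<open>A Kronecker delta in \<open>m = k + j\<close> is inserted to collect the terms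
      by order of differentiation.\<close>
    also have "\<dots> = (\<Sum>j\<le>n. \<Sum>k\<le>n. \<Sum>m\<le>2 * n. (if k + j = m then (-1) ^ j * G j k else 0) * ?Y m)"
      by (intro sum.cong refl) (simp add: if_distrib[of "\<lambda>x. x * _"] sum.delta' cong: if_cong)
    also have "\<dots> = (\<Sum>j\<le>n. \<Sum>m\<le>2 * n. \<Sum>k\<le>n. (if k + j = m then (-1) ^ j * G j k else 0) * ?Y m)"
      by (intro sum.cong refl sum.swap)
    also have "\<dots> = (\<Sum>m\<le>2 * n. \<Sum>j\<le>n. \<Sum>k\<le>n. (if k + j = m then (-1) ^ j * G j k else 0) * ?Y m)"
      by (rule sum.swap)
    also have "\<dots> = (\<Sum>m\<le>2 * n. el_coeff n G m * ?Y m)"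
      by (simp add: el_coeff_def sum_distrib_right)
    also have "\<dots> = (\<Sum>m<2 * n. el_coeff n G m * ?Y m) + D * ?Y (2 * n)"
      by (simp add: D_def flip: lessThan_Suc_atMost)
    finally have *: "(\<Sum>j\<le>n. (-1) ^ j * nderiv {0..T} j (\<lambda>s. partial_deriv j L (jet {0..T} y s)) t)
        = (\<Sum>m<2 * n. el_coeff n G m * ?Y m) + D * ?Y (2 * n)" .
    have **: "(\<Sum>m<2 * n. - el_coeff n G m / D * ?Y m) = - (\<Sum>m<2 * n. el_coeff n G m * ?Y m) / D"
      by (simp add: sum_negf sum_divide_distrib)
    have "S + D * x = 0 \<longleftrightarrow> x = - S / D" for S x
      using D by (auto simp: field_simps)
    then show ?thesis unfolding * ** .
  qed
  then show ?thesis using y unfolding euler_lagrange_def ode_solution_def D_def by auto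
qed

text \<open>Linear partial derivatives make the Euler-Lagrange equation linear with constant
  coefficients, and \<open>G n n \<noteq> 0\<close> gives it full order
  \<open>2 * n\<close>.\<close>

lemma almost_always_solvable_if_linear_partial_derivs:
  assumes n: "n \<ge> 1"
    and partial: "\<And>j v. j \<le> n \<Longrightarrow> partial_deriv j L v = (\<Sum>k\<le>n. G j k * v k)"
    and G: "G n n \<noteq> 0"
  shows "almost_always_solvable n L"
proof -
  define p where "p m = - el_coeff n G m / el_coeff n G (2 * n)" for m
  have sol: "bvp_solution n L T \<alpha> \<beta> y \<longleftrightarrow> ode_solution p (2 * n) T y \<and>
      (\<forall>i<n. nderiv {0..T} i y 0 = \<alpha> (Suc i) \<and> nderiv {0..T} i y T = \<beta> (Suc i))"
    if "0 < T" for T \<alpha> \<beta> y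
  proof -
    have "(\<forall>i\<in>{1..n}. P i) \<longleftrightarrow> (\<forall>i<n. P (Suc i))" for P
      by (metis One_nat_def Suc_le_eq Suc_pred atLeastAtMost_iff le_numeral_extra(4) less_Suc_eq_le zero_less_Suc)
    then show ?thesis
      using euler_lagrange_iff_ode[where L = L and G = G, OF that _ partial G]
      unfolding bvp_solution_def p_def[abs_def]
      by (auto simp: state_of_jet_def jet_def ode_solution_def)
  qed
  have "uniquely_solvable n L T" if T: "0 < T" and det: "bvp_det p n T \<noteq> 0" for T
    unfolding uniquely_solvable_def sol[OF T]
  proof (intro allI conjI impI ballI)
    fix \<alpha> \<beta> :: "nat \<Rightarrow> real"
    obtain y where "ode_solution p (2 * n) T y"
      "\<And>i. i < n \<Longrightarrow> nderiv {0..T} i y 0 = \<alpha> (Suc i)" "\<And>i. i < n \<Longrightarrow> nderiv {0..T} i y T = \<beta> (Suc i)"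
      by (rule bvp_exists[OF T det, of "\<lambda>i. \<alpha> (Suc i)" "\<lambda>i. \<beta> (Suc i)"]) auto
    then show "\<exists>y. ode_solution p (2 * n) T y \<and>
        (\<forall>i<n. nderiv {0..T} i y 0 = \<alpha> (Suc i) \<and> nderiv {0..T} i y T = \<beta> (Suc i))"
      by blast
  next
    fix \<alpha> \<beta> :: "nat \<Rightarrow> real" and y z t
    assume "ode_solution p (2 * n) T y \<and>
        (\<forall>i<n. nderiv {0..T} i y 0 = \<alpha> (Suc i) \<and> nderiv {0..T} i y T = \<beta> (Suc i))"
      and "ode_solution p (2 * n) T z \<and>
        (\<forall>i<n. nderiv {0..T} i z 0 = \<alpha> (Suc i) \<and> nderiv {0..T} i z T = \<beta> (Suc i))"
      and "t \<in> {0..T}"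
    then show "y t = z t"
      by (intro bvp_unique[where y = y and z = z and t = t, OF T det _ _ _ _ n]) auto
  qed
  \<comment> \<open>Exceptional times are zeros of the determinant, and sparseness passes to
    subsets.\<close>
  then have "{T. 0 < T \<and> \<not> uniquely_solvable n L T} \<subseteq> {T. bvp_det p n T = 0}" by blast
  then have "{T. 0 < T \<and> \<not> uniquely_solvable n L T} sparse_in UNIV"
    by (rule sparse_in_subset2[OF bvp_det_zeros_sparse])
  then show ?thesis
    unfolding almost_always_solvable_def by (rule sparse_in_subset) simp
qed

text \<open>The array \<open>g\<close> may be asymmetric, so the product rule produces both
  \<open>g j k\<close> and \<open>g k j\<close>.\<close>

lemma partial_deriv_quadratic:
  assumes L: "\<And>v. L v = (\<Sum>i\<le>n. \<Sum>k\<le>n. g i k * v i * v k)" and j: "j \<le> n"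
  shows "partial_deriv j L v = (\<Sum>k\<le>n. (g j k + g k j) * v k)"
proof -
  let ?\<delta> = "\<lambda>i. if i = j then 1 else 0 :: real"
  have coord: "((\<lambda>s. (v(j := s)) i) has_real_derivative ?\<delta> i) (at (v j))" for i
    by auto
  have "((\<lambda>s. L (v(j := s))) has_real_derivative
      (\<Sum>i\<le>n. \<Sum>k\<le>n. g i k * (?\<delta> i * v k + v i * ?\<delta> k))) (at (v j))"
    unfolding L mult.assoc
    using DERIV_mult[OF coord coord]
    by (intro DERIV_sum DERIV_cmult) (simp add: algebra_simps)
  then have "partial_deriv j L v = (\<Sum>i\<le>n. \<Sum>k\<le>n. g i k * (?\<delta> i * v k + v i * ?\<delta> k))"
    unfolding partial_deriv_def by (rule DERIV_imp_deriv)
  also have "\<dots> = (\<Sum>i\<le>n. ?\<delta> i * (\<Sum>k\<le>n. g i k * v k)) + (\<Sum>i\<le>n. \<Sum>k\<le>n. g i k * v i * ?\<delta> k)"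
    by (simp add: distrib_left sum.distrib sum_distrib_left mult_ac)
  also have "\<dots> = (\<Sum>k\<le>n. g j k * v k) + (\<Sum>i\<le>n. g i j * v i)"
    using j by (simp add: if_distrib[of "(*) _"] if_distrib[of "\<lambda>x. x * _"] sum.delta cong: if_cong)
  finally show ?thesis by (simp add: sum.distrib distrib_right)
qed

text \<open>Setting \<open>h n = 1\<close> absorbs the top derivative into the linear form of the
  control, whose square contributes the products \<open>h i * h k\<close>.\<close>

lemma lagrangian_quadratic:
  fixes a :: "nat \<Rightarrow> real" and b r :: real
  assumes "\<And>x. Q x = (\<Sum>i=1..n. \<Sum>j=1..n. q i j * x i * x j)"
  defines "h \<equiv> a(n := 1)"
  defines "g \<equiv> \<lambda>i k. (if i < n \<and> k < n then q (Suc i) (Suc k) else 0) + r / b\<^sup>2 * h i * h k"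
  shows "lagrangian n a b Q r v = (\<Sum>i\<le>n. \<Sum>k\<le>n. g i k * v i * v k)"
proof -
  have Q: "Q (state_of_jet v) = (\<Sum>i\<le>n. \<Sum>k\<le>n. (if i < n \<and> k < n then q (Suc i) (Suc k) else 0) * v i * v k)"
    by (simp add: assms(1) sum.atLeast1_atMost_eq state_of_jet_def flip: lessThan_Suc_atMost)
  have "v n + (\<Sum>i<n. a i * v i) = (\<Sum>i\<le>n. h i * v i)"
    by (simp add: h_def flip: lessThan_Suc_atMost)
  then have "r * (control_of_jet n a b v)\<^sup>2 = r / b\<^sup>2 * ((\<Sum>i\<le>n. h i * v i) * (\<Sum>i\<le>n. h i * v i))"
    by (simp add: control_of_jet_def power_divide power2_eq_square)
  also have "\<dots> = (\<Sum>i\<le>n. \<Sum>k\<le>n. r / b\<^sup>2 * h i * h k * v i * v k)"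
    by (simp add: sum_product sum_distrib_left mult_ac)
  finally show ?thesis
    unfolding lagrangian_def integrand_def Q g_def by (simp add: distrib_right sum.distrib)
qed

theorem corollary15:
  fixes n :: nat and a :: "nat \<Rightarrow> real" and b r :: real
    and Q :: "(nat \<Rightarrow> real) \<Rightarrow> real"
  assumes "n \<ge> 1" and "b \<noteq> 0"
    and "quadratic_form n Q" and "r \<noteq> 0"
  shows "almost_always_solvable n (lagrangian n a b Q r)"
proof -
  obtain q where q: "Q x = (\<Sum>i=1..n. \<Sum>j=1..n. q i j * x i * x j)" for x
    using assms(3) unfolding quadratic_form_def by blast
  show ?thesis
    \<comment> \<open>\<open>Q\<close> involves only orders below \<open>n\<close>, so the top entry
      is twice \<open>r / b\<^sup>2\<close>, which is nonzero.\<close>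
    by (rule almost_always_solvable_if_linear_partial_derivs[OF assms(1)
          partial_deriv_quadratic[OF lagrangian_quadratic[OF q]]])
      (use assms in auto)
qed

end
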